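(* Let $n>c_1>c_2\ge0$ and $\Sigma$ be natural numbers with $\Sigma$ even and $nc_1\ge\Sigma\ge nc_2$. The following are equivalent: (1) $\mathrm{LEG}(n,\Sigma,c_1,c_2)=(e_1,\dots,e_n)$ satisfies $\sum_{i=1}^k e_i\le k(k-1)+e_n(n-k)+1$ for all $k\in\{1,\dots,n\}$; (2) every $D=(d_1,\dots,d_n)\in\mathcal D(n,\Sigma,c_1,c_2)$ satisfies $\sum_{i=1}^k d_i\le k(k-1)+d_n(n-k)+1$ for all $k\in\{1,\dots,n\}$.
   Context: $\mathcal D(n,\Sigma,c_1,c_2)$ is the set of integer sequences $(d_1,\dots,d_n)$ with $c_1\ge d_1\ge\dots\ge d_n\ge c_2$, $\sum_i d_i$ even and $\sum_i d_i=\Sigma$. With $\alpha=\lfloor(\Sigma-nc_2)/(c_1-c_2)\rfloor$ and $a=\Sigma-(\alpha c_1+(n-1-\alpha)c_2)$, $\mathrm{LEG}(n,\Sigma,c_1,c_2)$ is the sequence consisting of $\alpha$ entries $c_1$, then $a$, then $n-1-\alpha$ entries $c_2$. *)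

theory Defs
  imports Main
begin

text \<open>
  A sequence \<open>(d\<^sub>1, \<dots>, d\<^sub>n)\<close> of integers is an \<open>int list\<close> of length \<open>n\<close>; since list indexing
  starts at 0, \<open>d\<^sub>i\<close> is \<open>d ! (i - 1)\<close>.
\<close>

definition seqs :: "nat \<Rightarrow> nat \<Rightarrow> nat \<Rightarrow> nat \<Rightarrow> int list set" where
  "seqs n S c1 c2 =
     {d. length d = n \<and> sorted_wrt (\<ge>) d \<and>
         (\<forall>x\<in>set d. int c2 \<le> x \<and> x \<le> int c1) \<and>
         even (sum_list d) \<and> sum_list d = int S}"

definition leg_alpha :: "nat \<Rightarrow> nat \<Rightarrow> nat \<Rightarrow> nat \<Rightarrow> nat" where
  "leg_alpha n S c1 c2 = nat ((int S - int n * int c2) div (int c1 - int c2))"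

definition leg_a :: "nat \<Rightarrow> nat \<Rightarrow> nat \<Rightarrow> nat \<Rightarrow> int" where
  "leg_a n S c1 c2 =
     int S - (int (leg_alpha n S c1 c2) * int c1
              + (int n - 1 - int (leg_alpha n S c1 c2)) * int c2)"

text \<open>
  In the boundary case \<open>S = n * c1\<close> we have \<open>\<alpha> = n\<close> and \<open>a = c2\<close>, and the number \<open>n - 1 - \<alpha>\<close> of
  entries \<open>c2\<close> is \<open>-1\<close>. The sequence of length \<open>n\<close> is then constantly \<open>c1\<close>, which
  is what \<open>take n\<close> yields. If \<open>\<alpha> < n\<close>, the list already has length \<open>n\<close>.
\<close>

definition LEG :: "nat \<Rightarrow> nat \<Rightarrow> nat \<Rightarrow> nat \<Rightarrow> int list" where
  "LEG n S c1 c2 =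
     take n (replicate (leg_alpha n S c1 c2) (int c1)
             @ [leg_a n S c1 c2]
             @ replicate (n - 1 - leg_alpha n S c1 c2) (int c2))"

end

theory Submission
  imports Defs
begin

text \<open>
  Among all sequences in \<open>seqs n S c1 c2\<close> the sequence \<open>LEG n S c1 c2\<close> has the largest partial
  sums: a sum of \<open>k\<close> entries is at most both \<open>k * c1\<close> and \<open>S - (n - k) * c2\<close>, and \<open>LEG\<close> attains
  one of these bounds for each \<open>k\<close>. Since the total sums agree, the case \<open>k = n - 1\<close> says that
  \<open>LEG\<close> has the smallest last entry. Hence passing from \<open>LEG\<close> to any other sequence decreases the
  left-hand side of each inequality and increases the right-hand side.
\<close>

text \<open>Turns the indexed sums of the theorem into sums over \<open>take k d\<close>, so that a
  list can be split into a prefix and a rest.\<close>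

lemma sum_nth_eq_sum_list_take:
  fixes d :: "'a::comm_monoid_add list"
  assumes "k \<le> length d"
  shows "(\<Sum>i = 1..k. d ! (i - 1)) = sum_list (take k d)"
  using assms
proof (induction k)
  case (Suc k)
  then show ?case
    by (simp add: take_Suc_conv_app_nth add.commute)
qed simp

lemma sum_list_le_length_mult:
  fixes xs :: "int list"
  assumes "\<And>x. x \<in> set xs \<Longrightarrow> x \<le> c"
  shows "sum_list xs \<le> int (length xs) * c"
  using assms by (induction xs) (force simp: algebra_simps)+

lemma length_mult_le_sum_list:
  fixes xs :: "int list"
  assumes "\<And>x. x \<in> set xs \<Longrightarrow> c \<le> x"
  shows "int (length xs) * c \<le> sum_list xs"
  using assms by (induction xs) (force simp: algebra_simps)+

lemma seqs_sum_list_take_le: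
  assumes "d \<in> seqs n S c1 c2" "k \<le> n"
  shows "sum_list (take k d) \<le> int k * int c1"
    and "sum_list (take k d) \<le> int S - (int n - int k) * int c2"
proof -
  have len: "length d = n" and sum: "sum_list d = int S"
    and bounds: "\<forall>x\<in>set d. int c2 \<le> x \<and> x \<le> int c1"
    using assms(1) by (auto simp: seqs_def)
  show "sum_list (take k d) \<le> int k * int c1"
    using sum_list_le_length_mult[of "take k d" "int c1"] bounds len assms(2)
    by (auto dest: in_set_takeD)
  \<comment> \<open>The second bound comes from the complement: each of the remaining
    \<open>n - k\<close> entries is at least \<open>c2\<close>.\<close>
  have "int (length (drop k d)) * int c2 \<le> sum_list (drop k d)"
    using bounds by (intro length_mult_le_sum_list) (auto dest: in_set_dropD)
  moreover have "sum_list (take k d) + sum_list (drop k d) = int S"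
    using sum by (metis append_take_drop_id sum_list_append)
  ultimately show "sum_list (take k d) \<le> int S - (int n - int k) * int c2"
    using len assms(2) by (simp add: of_nat_diff)
qed

lemma sorted_wrt_replicate:
  assumes "P x x"
  shows "sorted_wrt P (replicate m x)"
  using assms by (induction m) auto

text \<open>Division with remainder: for \<open>t = S - n * c2\<close> and
  \<open>c = c1 - c2\<close>, the quotient \<open>t div c\<close> is \<open>leg_alpha\<close> and
  the remainder \<open>t mod c\<close> is \<open>leg_a - c2\<close>.\<close>

lemma leg_bounds:
  assumes "c1 > c2" "n * c1 \<ge> S" "S \<ge> n * c2"
  shows "leg_alpha n S c1 c2 \<le> n"
    and "int c2 \<le> leg_a n S c1 c2" "leg_a n S c1 c2 < int c1"
    and "leg_alpha n S c1 c2 = n \<Longrightarrow> S = n * c1"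
proof -
  define c where "c = int c1 - int c2"
  define t where "t = int S - int n * int c2"
  have c: "c > 0" using assms(1) by (simp add: c_def)
  have t0: "t \<ge> 0" using assms(3) unfolding t_def
    by (metis diff_ge_0_iff_ge of_nat_mult of_nat_le_iff)
  have "int S \<le> int n * int c1" using assms(2)
    by (metis of_nat_mult of_nat_le_iff)
  then have tn: "t \<le> int n * c" by (simp add: t_def c_def algebra_simps)
  \<comment> \<open>As \<open>t \<ge> 0\<close>, the conversion by \<open>nat\<close> truncates
    nothing.\<close>
  have alpha: "int (leg_alpha n S c1 c2) = t div c"
    using t0 c by (simp add: leg_alpha_def t_def c_def pos_imp_zdiv_nonneg_iff)
  have a: "leg_a n S c1 c2 = int c2 + t mod c"
    unfolding leg_a_def alpha minus_mult_div_eq_mod[symmetric]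
    by (simp add: t_def c_def algebra_simps)
  show "int c2 \<le> leg_a n S c1 c2" "leg_a n S c1 c2 < int c1"
    using a pos_mod_sign[OF c, of t] pos_mod_bound[OF c, of t] c_def by linarith+
  have "t div c \<le> int n"
    using zdiv_mono1[OF tn c] c by simp
  then show "leg_alpha n S c1 c2 \<le> n" using alpha by linarith
  show "S = n * c1" if "leg_alpha n S c1 c2 = n"
  proof -
    \<comment> \<open>If the quotient is \<open>n\<close>, this gives \<open>n * c \<le> t\<close>,
      the converse of \<open>tn\<close>.\<close>
    have "t div c * c \<le> t"
      using div_mult_mod_eq[of t c] pos_mod_sign[OF c, of t] by linarith
    then have "int n * c \<le> t" using that alpha by simp
    then have "int S = int n * int c1" using tn
      by (simp add: t_def c_def algebra_simps)
    then show ?thesis by (metis of_nat_mult of_nat_eq_iff)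
  qed
qed

lemma length_LEG [simp]: "length (LEG n S c1 c2) = n"
  by (auto simp: LEG_def)

text \<open>By the choice of \<open>leg_a\<close>, the first \<open>leg_alpha + 1\<close> entries
  sum to \<open>S - (n - 1 - leg_alpha) * c2\<close>, and each later entry adds \<open>c2\<close>.
  If \<open>leg_alpha < k \<le> n\<close>, then \<open>leg_alpha < n\<close>, so
  \<open>take n\<close> keeps \<open>leg_a\<close> and the natural subtraction is exact.\<close>

lemma sum_list_take_LEG:
  assumes "k \<le> n"
  shows "sum_list (take k (LEG n S c1 c2)) =
    (if k \<le> leg_alpha n S c1 c2 then int k * int c1 else int S - (int n - int k) * int c2)"
  using assms
  by (auto simp: LEG_def leg_a_def min_def sum_list_replicate take_Cons' algebra_simps of_nat_diff)

lemma LEG_in_seqs: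
  assumes "c1 > c2" "even S" "n * c1 \<ge> S" "S \<ge> n * c2"
  shows "LEG n S c1 c2 \<in> seqs n S c1 c2"
proof -
  note bounds = leg_bounds[OF assms(1,3,4)]
  \<comment> \<open>Take \<open>k = n\<close>: the first branch applies only if
    \<open>leg_alpha = n\<close>, and then \<open>S = n * c1\<close>.\<close>
  have "sum_list (LEG n S c1 c2) = int S"
    using sum_list_take_LEG[of n n S c1 c2] bounds(1,4) by (auto split: if_splits)
  moreover have "sorted_wrt (\<ge>) (LEG n S c1 c2)"
    using bounds(2,3) assms(1) unfolding LEG_def
    by (intro sorted_wrt_take) (auto simp: sorted_wrt_append sorted_wrt_replicate)
  moreover have "\<forall>x\<in>set (LEG n S c1 c2). int c2 \<le> x \<and> x \<le> int c1"
    using bounds(2,3) assms(1) by (auto simp: LEG_def dest!: in_set_takeD)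
  ultimately show ?thesis using assms(2) by (simp add: seqs_def)
qed

lemma seqs_sum_list_take_le_LEG:
  assumes "d \<in> seqs n S c1 c2" "k \<le> n"
  shows "sum_list (take k d) \<le> sum_list (take k (LEG n S c1 c2))"
  using seqs_sum_list_take_le[OF assms] sum_list_take_LEG[OF assms(2), of S c1 c2] by auto

lemma sum_list_eq_take_last:
  fixes d :: "'a::comm_monoid_add list"
  assumes "length d = n" "n > 0"
  shows "sum_list d = sum_list (take (n - 1) d) + d ! (n - 1)"
proof -
  have "d = take (n - 1) d @ [d ! (n - 1)]"
    using assms take_Suc_conv_app_nth[of "n - 1" d] by simp
  then have "sum_list d = sum_list (take (n - 1) d @ [d ! (n - 1)])" by (rule arg_cong)
  then show ?thesis by simp
qed

lemma LEG_last_le: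
  assumes "d \<in> seqs n S c1 c2" "LEG n S c1 c2 \<in> seqs n S c1 c2" "n > 0"
  shows "LEG n S c1 c2 ! (n - 1) \<le> d ! (n - 1)"
proof -
  have "length d = n" "sum_list d = sum_list (LEG n S c1 c2)"
    using assms by (auto simp: seqs_def)
  then show ?thesis
    using seqs_sum_list_take_le_LEG[OF assms(1), of "n - 1"]
      sum_list_eq_take_last[of d n] sum_list_eq_take_last[of "LEG n S c1 c2" n] assms(3)
    by simp
qed

theorem theorem4p6:
  fixes n c1 c2 S :: nat
  assumes "n > c1" and "c1 > c2" and "c2 \<ge> 0"
    and "even S"
    and "n * c1 \<ge> S" and "S \<ge> n * c2"
  shows "(\<forall>k\<in>{1..n}.
            (\<Sum>i = 1..k. LEG n S c1 c2 ! (i - 1))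
              \<le> int k * (int k - 1) + LEG n S c1 c2 ! (n - 1) * (int n - int k) + 1)
     \<longleftrightarrow> (\<forall>d\<in>seqs n S c1 c2. \<forall>k\<in>{1..n}.
            (\<Sum>i = 1..k. d ! (i - 1))
              \<le> int k * (int k - 1) + d ! (n - 1) * (int n - int k) + 1)"
    (is "?leg \<longleftrightarrow> ?all")
proof
  note leg = LEG_in_seqs[OF assms(2,4,5,6)]
  show ?leg if ?all using that leg by blast
  show ?all if ?leg
  proof (intro ballI)
    fix d k
    assume d: "d \<in> seqs n S c1 c2" and k: "k \<in> {1..n}"
    have len: "length d = n" using d by (simp add: seqs_def)
    have "(\<Sum>i = 1..k. d ! (i - 1)) \<le> (\<Sum>i = 1..k. LEG n S c1 c2 ! (i - 1))"
      using seqs_sum_list_take_le_LEG[OF d, of k] k len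
      by (simp only: sum_nth_eq_sum_list_take length_LEG atLeastAtMost_iff)
    also have "\<dots> \<le> int k * (int k - 1) + LEG n S c1 c2 ! (n - 1) * (int n - int k) + 1"
      using that k by blast
    \<comment> \<open>The factor \<open>n - k\<close> is nonnegative, so the smaller last entry of
      \<open>LEG\<close> gives the smaller right-hand side.\<close>
    also have "\<dots> \<le> int k * (int k - 1) + d ! (n - 1) * (int n - int k) + 1"
      using LEG_last_le[OF d leg] k by (intro add_mono mult_right_mono) auto
    finally show "(\<Sum>i = 1..k. d ! (i - 1))
      \<le> int k * (int k - 1) + d ! (n - 1) * (int n - int k) + 1" .
  qed
qed

end
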